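(* Let $p \geq 5$ be a prime number. Then, for any Mersenne prime $M \in \mathbb{F}_2[x]$ with $M \notin \Sigma_p$, the polynomial $\phi_p(M) = 1 + M + \cdots + M^{p-1} = \sigma(M^{p-1})$ is divisible by a non Mersenne prime, i.e. by an irreducible polynomial of $\mathbb{F}_2[x]$ that is not a Mersenne prime.
   Context: A Mersenne prime (polynomial) over $\mathbb{F}_2$ is an irreducible polynomial in $\mathbb{F}_2[x]$ of the form $1 + x^a(x+1)^b$ with $a, b$ positive integers. For a nonzero $A \in \mathbb{F}_2[x]$, $\sigma(A) \in \mathbb{F}_2[x]$ denotes the sum of all divisors of $A$ in $\mathbb{F}_2[x]$. $\phi_p$ is the $p$-th cyclotomic polynomial (reduced mod 2). For a nonzero $S \in \mathbb{F}_2[x]$ of degree $s$ and $0 \le l \le s$, $\alpha_l(S)$ denotes the coefficient of $x^{s-l}$ in $S$ (so $\alpha_0(S) = 1$). Given a prime $p = 2h+1 \ge 5$ and a Mersenne prime $M = 1 + x^a(x+1)^b$, set - $\deg_M := \deg(M) = a+b$, - $U_{2h} := \sigma(\sigma(M^{2h}))$, - $W_M := U_{2h} + \sigma(M^{2h}) + 1$, - $c_M := 2h\deg_M - \deg(W_M)$ (for $W_M \neq 0$), - $m_M$ := the least odd integer $m \ge 1$ such that $\alpha_m(W_M) = 1$, considered when $\deg(W_M)$ is even (equivalently, when $c_M$ is even) and such an $m$ exists. A Mersenne prime $M$ for which a quantity appearing in a condition below is undefined does not satisfy that condition. Define the following sets of Mersenne primes: $\Sigma_p^1 := \{M : c_M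 = \deg_M\}$, $\Sigma_p^2 := \{M : c_M = \deg_M + 1,\ c_M \text{ odd}\}$, $\Sigma_p^3 := \{M : c_M + m_M = \deg_M,\ c_M \text{ even}\}$, $\Sigma_p^4 := \{M : c_M + m_M = \deg_M + 1,\ c_M \text{ even and } m_M \ge 3\}$, and $\Sigma_p := \Sigma_p^1 \cup \Sigma_p^2 \cup \Sigma_p^3 \cup \Sigma_p^4$. *)

theory Defs
  imports Complex_Main "HOL-Library.Z2" "HOL-Computational_Algebra.Computational_Algebra"
begin

text \<open>The field of two elements is the type \<^typ>\<open>bit\<close>, so the ring
  of polynomials over it is \<^typ>\<open>bit poly\<close>; its only unit is 1.\<close>

definition mersenne_prime :: "bit poly \<Rightarrow> bool" where
  "mersenne_prime M \<longleftrightarrow> irreducible M \<and>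
     (\<exists>a b. a \<ge> 1 \<and> b \<ge> 1 \<and> M = 1 + [:0, 1:] ^ a * [:1, 1:] ^ b)"

text \<open>Used only for nonzero arguments, which have finitely many divisors.\<close>

definition sigma :: "bit poly \<Rightarrow> bit poly" where
  "sigma A = (\<Sum>D | D dvd A. D)"

text \<open>The product of \<open>X - \<zeta>\<close> over the primitive \<open>n\<close>-th roots of unity \<open>\<zeta>\<close>
  has integer coefficients; embedding the integer polynomials into the complex ones
  is injective, so at most one polynomial satisfies the condition.\<close>

definition cyclotomic :: "nat \<Rightarrow> int poly" where
  "cyclotomic n = (THE q. map_poly complex_of_int q =
     (\<Prod>k | 1 \<le> k \<and> k \<le> n \<and> coprime k n. [:- cis (2 * pi * real k / real n), 1:]))"

definition cyclotomic_mod2 :: "nat \<Rightarrow> bit poly" where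
  "cyclotomic_mod2 n = map_poly of_int (cyclotomic n)"

text \<open>Meaningful for \<open>l \<le> degree S\<close> only (the subtraction is truncated).\<close>

definition alpha :: "nat \<Rightarrow> bit poly \<Rightarrow> bit" where
  "alpha l S = coeff S (degree S - l)"

definition U_poly :: "nat \<Rightarrow> bit poly \<Rightarrow> bit poly" where
  "U_poly p M = (let h = (p - 1) div 2 in sigma (sigma (M ^ (2 * h))))"

definition W_poly :: "nat \<Rightarrow> bit poly \<Rightarrow> bit poly" where
  "W_poly p M = (let h = (p - 1) div 2 in U_poly p M + sigma (M ^ (2 * h)) + 1)"

definition c_num :: "nat \<Rightarrow> bit poly \<Rightarrow> int" where
  "c_num p M = (let h = (p - 1) div 2 in
     2 * int h * int (degree M) - int (degree (W_poly p M)))"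

definition is_odd_index :: "nat \<Rightarrow> bit poly \<Rightarrow> nat \<Rightarrow> bool" where
  "is_odd_index p M m \<longleftrightarrow>
     odd m \<and> m \<le> degree (W_poly p M) \<and> alpha m (W_poly p M) = 1"

definition m_num :: "nat \<Rightarrow> bit poly \<Rightarrow> nat" where
  "m_num p M = (LEAST m. is_odd_index p M m)"

text \<open>\<^const>\<open>c_num\<close> is defined only if \<^const>\<open>W_poly\<close> is nonzero, and
  \<^const>\<open>m_num\<close> only if moreover some odd index exists. A Mersenne prime for
  which a quantity in a condition is undefined does not satisfy that condition.\<close>

definition c_defined :: "nat \<Rightarrow> bit poly \<Rightarrow> bool" where
  "c_defined p M \<longleftrightarrow> W_poly p M \<noteq> 0"

definition m_defined :: "nat \<Rightarrow> bit poly \<Rightarrow> bool" where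
  "m_defined p M \<longleftrightarrow>
     c_defined p M \<and> even (degree (W_poly p M)) \<and> (\<exists>m. is_odd_index p M m)"

definition Sigma1 :: "nat \<Rightarrow> bit poly set" where
  "Sigma1 p = {M. mersenne_prime M \<and> c_defined p M \<and> c_num p M = int (degree M)}"

definition Sigma2 :: "nat \<Rightarrow> bit poly set" where
  "Sigma2 p = {M. mersenne_prime M \<and> c_defined p M \<and>
     c_num p M = int (degree M) + 1 \<and> odd (c_num p M)}"

definition Sigma3 :: "nat \<Rightarrow> bit poly set" where
  "Sigma3 p = {M. mersenne_prime M \<and> c_defined p M \<and> m_defined p M \<and>
     c_num p M + int (m_num p M) = int (degree M) \<and> even (c_num p M)}"

definition Sigma4 :: "nat \<Rightarrow> bit poly set" where
  "Sigma4 p = {M. mersenne_prime M \<and> c_defined p M \<and> m_defined p M \<and>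
     c_num p M + int (m_num p M) = int (degree M) + 1 \<and> even (c_num p M) \<and> m_num p M \<ge> 3}"

definition Sigma_set :: "nat \<Rightarrow> bit poly set" where
  "Sigma_set p = Sigma1 p \<union> Sigma2 p \<union> Sigma3 p \<union> Sigma4 p"

end

theory Submission
  imports Defs
begin

text \<open>Let \<open>S = \<Sum>i<p. M ^ i\<close>, which is squarefree, and suppose that all its irreducible factors
  are Mersenne primes \<open>P\<close>. Then \<open>sigma S\<close> is the product of the \<open>1 + P\<close>, of the form
  \<open>X ^ u * (X + 1) ^ v\<close>. The second highest coefficient is additive on products; for \<open>S\<close> it
  vanishes, and for each \<open>P\<close> it is the parity of the exponent of \<open>X + 1\<close>. Hence \<open>v\<close> is even, and
  so is \<open>u\<close>, because \<open>u + v = degree S\<close> is even. Thus \<open>sigma S\<close> is a square without odd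
  exponents, and \<open>W_poly p M\<close> has the same odd exponents as \<open>S\<close>. The largest of those lies
  \<open>degree M\<close> or \<open>degree M + 1\<close> (whichever is odd) below \<open>degree S\<close>, which puts \<open>M\<close> into
  \<open>Sigma_set p\<close>.\<close>

lemma degree_power_sum_le:
  fixes M :: "'a::comm_semiring_1 poly"
  shows "degree (\<Sum>i<n. M ^ i) \<le> (n - 1) * degree M"
proof (rule degree_sum_le)
  fix i assume "i \<in> {..<n}"
  then have "degree M * i \<le> degree M * (n - 1)" by (intro mult_left_mono) auto
  then show "degree (M ^ i) \<le> (n - 1) * degree M"
    using degree_power_le[of M i] by (simp only: mult.commute[of "n - 1"])
qed simp

section \<open>Cyclotomic polynomials of prime index\<close>

text \<open>The derivative n X^(n-1) vanishes at most at 0, which is not a root of X^n - 1. So the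
  roots are simple, and a monic complex polynomial with simple roots is the product of its linear
  factors.\<close>

lemma prod_roots_of_unity:
  assumes "n > 0"
  shows "(\<Prod>k<n. [:- cis (2 * pi * real k / real n), 1:]) = monom 1 n - 1"
proof -
  let ?f = "monom 1 n - 1 :: complex poly"
  have lc: "degree ?f = n" "coeff ?f n = 1"
  proof -
    have "degree (monom 1 n + (- 1) :: complex poly) = degree (monom (1::complex) n)"
      using assms by (intro degree_add_eq_left) (simp add: degree_monom_eq)
    then show "degree ?f = n" by (simp add: degree_monom_eq)
    show "coeff ?f n = 1" using assms by simp
  qed
  have "rsquarefree ?f"
    using assms
    by (auto simp: rsquarefree_roots poly_monom pderiv_diff pderiv_monom power_0_left)
  then have "smult (lead_coeff ?f) (\<Prod>z | poly ?f z = 0. [:-z, 1:]) = ?f"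
    by (rule complex_poly_decompose_rsquarefree)
  then have "(\<Prod>z | z ^ n = 1. [:-z, 1:]) = ?f"
    unfolding lc by (simp add: poly_monom)
  then show ?thesis
    using prod.reindex_bij_betw[OF bij_betw_roots_unity[OF assms], of "\<lambda>z. [:-z, 1:]"] by simp
qed

text \<open>For prime p only k = p fails to be coprime to p, so the defining product is X^p - 1 with
  the factor X - 1 cancelled, a geometric sum.\<close>

lemma cyclotomic_prime:
  assumes "prime p"
  shows "cyclotomic p = (\<Sum>i<p. monom 1 i)"
proof -
  let ?Q = "\<lambda>k. [:- cis (2 * pi * real k / real p), 1:]"
  have p: "p > 1" using assms by (rule prime_gt_1_nat)
  have "coprime k p \<longleftrightarrow> k < p" if "1 \<le> k" "k \<le> p" for k
  proof
    show "k < p" if "coprime k p"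
      using that p \<open>k \<le> p\<close> by (cases "k = p") auto
    show "coprime k p" if "k < p"
      using that assms \<open>1 \<le> k\<close>
      by (metis coprime_commute dvd_imp_le not_less not_one_le_zero neq0_conv prime_imp_coprime)
  qed
  then have idx: "{k. 1 \<le> k \<and> k \<le> p \<and> coprime k p} = {..<p} - {0}" by auto
  let ?X = "[:0, 1:] :: complex poly"
  have X: "monom 1 i = ?X ^ i" for i by (simp add: monom_altdef)
  have "?Q 0 * prod ?Q ({..<p} - {0}) = ?X ^ p - 1"
    using p prod_roots_of_unity[of p] by (subst prod.remove[symmetric]) (auto simp: X)
  also have "\<dots> = (?X - 1) * (\<Sum>i<p. ?X ^ i)" by (rule power_diff_1_eq)
  also have "?X - 1 = ?Q 0" by (simp add: one_pCons)
  finally have prod_eq: "prod ?Q ({..<p} - {0}) = (\<Sum>i<p. monom 1 i)"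
    using mult_left_cancel[of "?Q 0"] by (simp add: X del: mult_pCons_left)
  have of_int: "map_poly complex_of_int (\<Sum>i<p. monom 1 i) = (\<Sum>i<p. monom 1 i)"
    by (rule poly_eqI) (auto simp: coeff_map_poly coeff_sum)
  show ?thesis
    unfolding cyclotomic_def idx prod_eq
  proof (rule the_equality)
    fix q assume "map_poly complex_of_int q = (\<Sum>i<p. monom 1 i)"
    then have "map_poly complex_of_int q = map_poly complex_of_int (\<Sum>i<p. monom 1 i)"
      by (simp add: of_int)
    then show "q = (\<Sum>i<p. monom 1 i)"
      by (metis (no_types, lifting) coeff_map_poly of_int_0 of_int_eq_iff poly_eqI)
  qed (rule of_int)
qed

lemma pcompose_cyclotomic_mod2:
  assumes "prime p"
  shows "pcompose (cyclotomic_mod2 p) M = (\<Sum>i<p. M ^ i)"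
proof -
  have "cyclotomic_mod2 p = (\<Sum>i<p. monom 1 i)"
    unfolding cyclotomic_mod2_def cyclotomic_prime[OF assms]
    by (rule poly_eqI) (auto simp: coeff_map_poly coeff_sum)
  moreover have "pcompose (monom 1 i) M = M ^ i" for i
    by (induction i) (simp_all add: monom_Suc pcompose_pCons pcompose_1)
  ultimately show ?thesis by (simp add: pcompose_sum)
qed

section \<open>Polynomials over the field of two elements\<close>

declare add_bit_eq_xor [simp del] mult_bit_eq_and [simp del]

lemma bit_add_self [simp]: "(a::bit) + a = 0"
  by (cases a) simp_all

lemma of_nat_bit: "(of_nat n :: bit) = of_bool (odd n)"
  by (induction n) auto

lemma bit_poly_add_self [simp]: "(q::bit poly) + q = 0"
  by (rule poly_eqI) (simp only: coeff_add bit_add_self coeff_0)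

lemma lead_coeff_bit_poly: "q \<noteq> (0::bit poly) \<Longrightarrow> lead_coeff q = 1"
  using leading_coeff_neq_0 bit_not_zero_iff by blast

lemma bit_poly_is_unit_iff: "is_unit q \<longleftrightarrow> q = (1::bit poly)"
proof
  assume "is_unit q"
  then obtain c where "c \<noteq> 0" "q = [:c:]" by (auto simp: is_unit_poly_iff dvd_field_iff)
  then show "q = 1" by (simp add: one_pCons)
qed simp

lemma pderiv_square_bit [simp]: "pderiv (q ^ 2 :: bit poly) = 0"
  by (simp add: power2_eq_square pderiv_mult)

text \<open>In characteristic 2 the derivative of a square is zero, and for odd n its coefficient at
  n - 1 is the coefficient of the square at n.\<close>

lemma coeff_square_odd:
  assumes "odd n"
  shows "coeff (q ^ 2 :: bit poly) n = 0"
proof -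
  from assms obtain k where "n = Suc k" by (cases n) auto
  then show ?thesis
    using coeff_pderiv[of "q ^ 2" k] assms by (simp add: of_nat_bit del: of_nat_Suc)
qed

section \<open>The second highest coefficient\<close>

text \<open>Reflection is multiplicative and turns the second highest coefficient into the linear
  one, which is easy to compute for products. Constants get the value 0.\<close>

definition subleading :: "'a::zero poly \<Rightarrow> 'a" where
  "subleading q = coeff (reflect_poly q) 1"

lemma subleading_altdef:
  "subleading q = (if degree q = 0 then 0 else coeff q (degree q - 1))"
  by (auto simp: subleading_def coeff_reflect_poly)

text \<open>The constant terms of the reflected polynomials are leading coefficients, hence 1, so
  the linear coefficients simply add.\<close>

lemma subleading_mult:
  fixes P Q :: "bit poly"
  assumes "P \<noteq> 0" "Q \<noteq> 0"
  shows "subleading (P * Q) = subleading P + subleading Q"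
  using assms
  by (simp add: subleading_def reflect_poly_mult coeff_mult lead_coeff_bit_poly)

lemma subleading_power:
  fixes P :: "bit poly"
  assumes "P \<noteq> 0"
  shows "subleading (P ^ n) = of_nat n * subleading P"
proof (induction n)
  case (Suc n)
  then show ?case using assms by (simp add: subleading_mult algebra_simps)
qed (simp add: subleading_def)

lemma degree_one_add:
  assumes "degree (N :: 'a::comm_ring_1 poly) \<ge> 1"
  shows "degree (1 + N) = degree N"
  using assms by (intro degree_add_eq_right) simp

lemma subleading_one_add:
  assumes "degree (N :: 'a::comm_ring_1 poly) \<ge> 2"
  shows "subleading (1 + N) = subleading N"
  using assms by (simp add: subleading_altdef degree_one_add coeff_1)

lemma degree_split: "degree ([:0, 1:] ^ a * [:1, 1:] ^ b :: bit poly) = a + b"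
  by (subst degree_mult_eq) (simp_all add: degree_linear_power)

lemma subleading_split: "subleading ([:0, 1:] ^ a * [:1, 1:] ^ b :: bit poly) = of_nat b"
  by (simp add: subleading_mult subleading_power) (simp add: subleading_altdef)

section \<open>Divisors and their sum\<close>

lemma finite_divisors_bit_poly:
  assumes "Q \<noteq> (0 :: bit poly)"
  shows "finite {D. D dvd Q}"
proof (rule finite_subset)
  let ?C = "{cs :: bit list. set cs \<subseteq> UNIV \<and> length cs \<le> Suc (degree Q)}"
  show "{D. D dvd Q} \<subseteq> Poly ` ?C"
  proof
    fix D assume "D \<in> {D. D dvd Q}"
    then have "degree D \<le> degree Q" using assms by (auto intro: dvd_imp_degree_le)
    then have "length (coeffs D) \<le> Suc (degree Q)"
      by (cases "D = 0") (simp_all add: length_coeffs_degree)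
    then show "D \<in> Poly ` ?C"
      by (intro image_eqI[of _ _ "coeffs D"]) simp_all
  qed
  have "finite (UNIV :: bit set)"
    by (rule finite_subset[of _ "{0, 1}"]) (auto intro: bit_not_zero_iff[THEN iffD1])
  then show "finite (Poly ` ?C)"
    by (intro finite_imageI finite_lists_length_le)
qed

text \<open>A divisor of \<open>P * Q\<close> is either a divisor of \<open>Q\<close> or
  \<open>P\<close> times one; since \<open>P\<close> does not divide \<open>Q\<close>, the two
  families are disjoint.\<close>

lemma sigma_irreducible_mult:
  assumes "irreducible P" "\<not> P dvd Q" "Q \<noteq> 0"
  shows "sigma (P * Q) = (1 + P) * sigma Q"
proof -
  have prime: "prime_elem P" using assms(1) by (rule field_poly_irreducible_imp_prime)
  then have P0: "P \<noteq> 0" by auto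
  have fin: "finite {D. D dvd Q}" using assms(3) by (rule finite_divisors_bit_poly)
  have "{D. D dvd P * Q} = {D. D dvd Q} \<union> (*) P ` {D. D dvd Q}"
  proof (intro equalityI subsetI)
    fix D assume "D \<in> {D. D dvd P * Q}"
    then obtain E where E: "P * Q = D * E" by (auto elim: dvdE)
    then have "P dvd D \<or> P dvd E" using prime prime_elem_dvd_multD by (metis dvd_triv_left)
    then show "D \<in> {D. D dvd Q} \<union> (*) P ` {D. D dvd Q}"
    proof
      assume "P dvd E"
      then obtain F where "E = P * F" by (elim dvdE)
      then have "Q = D * F" using E P0 by (simp add: mult.left_commute)
      then show ?thesis by simp
    next
      assume "P dvd D"
      then obtain F where F: "D = P * F" by (elim dvdE)
      then have "Q = F * E" using E P0 by (simp add: mult.assoc)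
      then show ?thesis using F by auto
    qed
  qed auto
  moreover have "{D. D dvd Q} \<inter> (*) P ` {D. D dvd Q} = {}"
    using assms(2) by (auto dest: dvd_mult_left)
  ultimately have "sigma (P * Q) = sigma Q + \<Sum>((*) P ` {D. D dvd Q})"
    using fin unfolding sigma_def by (simp add: sum.union_disjoint)
  also have "inj_on ((*) P) {D. D dvd Q}" using P0 by (auto simp: inj_on_def)
  then have "\<Sum>((*) P ` {D. D dvd Q}) = P * sigma Q"
    unfolding sigma_def by (simp add: sum.reindex sum_distrib_left)
  finally show ?thesis by (simp add: distrib_right)
qed

lemma prime_elem_dvd_prod:
  assumes "prime_elem P" "finite A" "P dvd prod f A"
  shows "\<exists>x\<in>A. P dvd f x"
  using assms(2,3)
proof (induction A rule: finite_induct)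
  case empty
  then show ?case using assms(1) prime_elem_not_unit by auto
next
  case (insert x A)
  then show ?case using prime_elem_dvd_multD[OF assms(1)] by auto
qed

lemma sigma_prod_irreducible:
  assumes "finite A" "\<And>P. P \<in> A \<Longrightarrow> irreducible P"
  shows "sigma (\<Prod>A) = (\<Prod>P\<in>A. 1 + P)"
  using assms
proof (induction A rule: finite_induct)
  case empty
  have "{D. D dvd (1 :: bit poly)} = {1}" by (auto simp: bit_poly_is_unit_iff)
  then show ?case by (simp add: sigma_def)
next
  case (insert P A)
  have prime: "prime_elem P" using insert.prems by (intro field_poly_irreducible_imp_prime) simp
  \<comment> \<open>As 1 is the only unit, an irreducible dividing another irreducible equals it, so
    distinct elements of the set are coprime.\<close>
  have "\<not> P dvd \<Prod>A"
  proof
    assume "P dvd \<Prod>A"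
    then obtain Q where Q: "Q \<in> A" "P dvd Q"
      using prime_elem_dvd_prod[OF prime insert.hyps(1), of "\<lambda>x. x"] by auto
    then obtain R where R: "Q = P * R" by (elim dvdE)
    have "P \<noteq> 1" using prime by auto
    moreover have "irreducible Q" using Q insert.prems by simp
    ultimately have "R = 1" using R irreducibleD by (metis bit_poly_is_unit_iff)
    then show False using R Q insert.hyps(2) by simp
  qed
  moreover have "\<Prod>A \<noteq> 0" using insert by (auto simp: irreducible_def)
  ultimately show ?case using insert by (simp add: sigma_irreducible_mult)
qed

text \<open>Primality of \<open>P\<close> makes every divisor of \<open>P ^ n\<close> a power of
  \<open>P\<close>; these powers are distinct because their degrees are.\<close>

lemma sigma_power_irreducible:
  assumes "irreducible P"
  shows "sigma (P ^ n) = (\<Sum>i\<le>n. P ^ i)"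
proof -
  have prime: "prime_elem P" using assms by (rule field_poly_irreducible_imp_prime)
  then have P: "P \<noteq> 0" "P \<noteq> 1" by auto
  have dvd: "\<exists>i\<le>n. D = P ^ i" if "D dvd P ^ n" for D n
    using that
  proof (induction n arbitrary: D)
    case 0
    then show ?case by (simp add: bit_poly_is_unit_iff)
  next
    case (Suc n)
    then obtain E where E: "P ^ Suc n = D * E" by (elim dvdE)
    then have "P dvd D \<or> P dvd E"
      using prime_elem_dvd_multD[OF prime, of D E] by (metis dvd_triv_left power_Suc)
    then show ?case
    proof
      assume "P dvd D"
      then obtain F where F: "D = P * F" by (elim dvdE)
      then have "P ^ n = F * E" using E P by (simp add: mult.assoc)
      then obtain i where "i \<le> n" "F = P ^ i" using Suc.IH[of F] by auto
      then show ?thesis using F by (intro exI[of _ "Suc i"]) simp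
    next
      assume "P dvd E"
      then obtain F where "E = P * F" by (elim dvdE)
      then have "P ^ n = D * F" using E P by (simp add: mult.left_commute)
      then obtain i where "i \<le> n" "D = P ^ i" using Suc.IH[of D] by auto
      then show ?thesis by (intro exI[of _ i]) simp
    qed
  qed
  have deg: "degree P > 0"
    using P lead_coeff_bit_poly[of P] by (cases "degree P = 0") (auto elim!: degree_eq_zeroE simp: one_pCons)
  have "inj_on ((^) P) {..n}"
  proof (rule inj_onI)
    fix i j assume "P ^ i = P ^ j"
    then have "degree (P ^ i) = degree (P ^ j)" by simp
    then show "i = j" using deg P by (simp add: degree_power_eq)
  qed
  moreover have "{D. D dvd P ^ n} = (^) P ` {..n}"
    using dvd by (auto intro: le_imp_power_dvd)
  ultimately show ?thesis unfolding sigma_def by (simp add: sum.reindex)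
qed

text \<open>Irreducible factors are split off by induction on the degree. Squarefreeness makes each
  one new, so a set can replace a multiset.\<close>

lemma squarefree_prod_irreducible:
  fixes Q :: "bit poly"
  assumes "Q \<noteq> 0" "\<And>P. irreducible P \<Longrightarrow> \<not> P ^ 2 dvd Q"
  obtains A where "finite A" "\<And>P. P \<in> A \<Longrightarrow> irreducible P" "Q = \<Prod>A"
proof -
  have "\<exists>A. finite A \<and> (\<forall>P\<in>A. irreducible P) \<and> Q = \<Prod>A"
    using assms
  proof (induction "degree Q" arbitrary: Q rule: less_induct)
    case less
    show ?case
    proof (cases "Q = 1")
      case True
      then show ?thesis by (intro exI[of _ "{}"]) simp
    next
      case False
      then have "\<exists>P. irreducible P \<and> P dvd Q"
        using less.prems(1)
      proof (induction "degree Q" arbitrary: Q rule: less_induct)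
        case (less Q)
        show ?case
        proof (cases "irreducible Q")
          case False
          then obtain R T where RT: "Q = R * T" "R \<noteq> 1" "T \<noteq> 1"
            using less.prems by (auto simp: irreducible_def bit_poly_is_unit_iff)
          then have "R \<noteq> 0" "T \<noteq> 0" using less.prems by auto
          moreover have "degree T > 0"
            using RT(3) \<open>T \<noteq> 0\<close>
            by (metis bit_poly_is_unit_iff gr0I is_unit_iff_degree)
          ultimately have "degree R < degree Q" using RT(1) by (simp add: degree_mult_eq)
          then obtain P where "irreducible P" "P dvd R"
            using less.hyps \<open>R \<noteq> 0\<close> RT(2) by blast
          then show ?thesis using RT(1) by auto
        qed auto
      qed
      then obtain P where "irreducible P" "P dvd Q" by blast
      then obtain R where P: "irreducible P" "Q = P * R" by (elim dvdE)
      then have nz: "P \<noteq> 0" "R \<noteq> 0" using less.prems by auto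
      have "degree P > 0"
        using P(1) nz(1) by (metis gr0I irreducible_def is_unit_iff_degree)
      then have "degree R < degree Q" using P nz by (simp add: degree_mult_eq)
      moreover have "\<not> T ^ 2 dvd R" if "irreducible T" for T
        using less.prems(2)[OF that] P(2) by auto
      ultimately obtain A where A: "finite A" "\<forall>P\<in>A. irreducible P" "R = \<Prod>A"
        using less.hyps nz by blast
      have "P \<notin> A"
      proof
        assume "P \<in> A"
        then have "P dvd R" using A by (auto intro: dvd_prodI)
        then have "P ^ 2 dvd Q" using P(2) by (simp add: power2_eq_square)
        then show False using less.prems(2) P(1) by blast
      qed
      then show ?thesis using A P by (intro exI[of _ "insert P A"]) simp
    qed
  qed
  then show ?thesis using that by blast
qed

section \<open>Mersenne primes\<close>

text \<open>If both exponents were even, \<open>M\<close> would be 1 plus a square, hence itself a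
  square in characteristic 2. The top two coefficients are not affected by the summand 1, as a + b
  \<ge> 2.\<close>

lemma mersenne_primeE:
  assumes "mersenne_prime M"
  obtains a b where "M = 1 + [:0, 1:] ^ a * [:1, 1:] ^ b" "a \<ge> 1" "b \<ge> 1" "odd a \<or> odd b"
    "degree M = a + b" "subleading M = of_nat b"
proof -
  from assms obtain a b where ab: "a \<ge> 1" "b \<ge> 1" "M = 1 + [:0, 1:] ^ a * [:1, 1:] ^ b"
    and irr: "irreducible M" unfolding mersenne_prime_def by auto
  have "odd a \<or> odd b"
  proof (rule ccontr)
    assume "\<not> (odd a \<or> odd b)"
    then obtain a' b' where "a = 2 * a'" "b = 2 * b'" by (auto elim!: evenE)
    then have "M = 1 + ([:0, 1:] ^ a' * [:1, 1:] ^ b') ^ 2"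
      using ab by (simp add: power_mult power_mult_distrib power_commutes mult.commute[of 2])
    then have "M = (1 + [:0, 1:] ^ a' * [:1, 1:] ^ b') ^ 2"
      by (simp add: power2_eq_square algebra_simps flip: add.assoc)
    then have "M = (1 + [:0, 1:] ^ a' * [:1, 1:] ^ b') * (1 + [:0, 1:] ^ a' * [:1, 1:] ^ b')"
      by (simp only: power2_eq_square)
    then show False using irr by (metis irreducible_def is_unit_mult_iff)
  qed
  moreover have "degree M = a + b" using ab by (simp add: degree_one_add degree_split)
  moreover have "subleading M = of_nat b"
    using ab by (simp add: subleading_one_add degree_split subleading_split)
  ultimately show ?thesis using that ab by blast
qed

text \<open>Let N = M - 1. A repeated factor \<open>P\<close> divides S and S', so differentiating 1
  + M^p = N S shows that it divides M^(p-1) N'. It does not divide \<open>M\<close>, so it divides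
  N', and then N itself. But modulo N the sum S is p = 1, a contradiction.\<close>

lemma mersenne_sum_squarefree:
  assumes "mersenne_prime M" "odd p" "irreducible P"
  shows "\<not> P ^ 2 dvd (\<Sum>i<p. M ^ i)"
proof
  let ?S = "\<Sum>i<p. M ^ i"
  assume sq: "P ^ 2 dvd ?S"
  from assms(1) obtain a b where ab: "M = 1 + [:0, 1:] ^ a * [:1, 1:] ^ b" "a \<ge> 1" "b \<ge> 1"
    "odd a \<or> odd b" by (rule mersenne_primeE)
  define N where "N = [:0, 1:] ^ a * [:1, 1 :: bit:] ^ b"
  have M: "M = 1 + N" using ab N_def by simp
  have prime: "prime_elem P" using assms(3) by (rule field_poly_irreducible_imp_prime)
  then have unit: "\<not> P dvd 1" by auto
  from sq obtain R where "?S = P ^ 2 * R" by (elim dvdE)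
  then have R: "?S = P * (P * R)" by (simp add: power2_eq_square mult.assoc)
  then have PS: "P dvd ?S" by simp
  have "pderiv ?S = P * (P * pderiv R + R * pderiv P) + P * R * pderiv P"
    by (simp add: R pderiv_mult algebra_simps)
  also have "\<dots> = P * (P * pderiv R)" by (simp add: algebra_simps flip: add.assoc)
  finally have PS': "P dvd pderiv ?S" by simp
  have minus: "x - 1 = 1 + x" for x :: "bit poly"
    by (rule poly_eqI) (simp add: add.commute)
  have "1 + M ^ p = N * ?S"
    using power_diff_1_eq[of M p] by (simp add: minus M flip: add.assoc)
  then have "pderiv (1 + M ^ p) = pderiv (N * ?S)" by simp
  then have "M ^ (p - 1) * pderiv N = N * pderiv ?S + ?S * pderiv N"
    using assms(2) by (simp add: pderiv_add pderiv_power pderiv_mult M of_nat_bit)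
  then have "P dvd M ^ (p - 1) * pderiv N" using PS PS' by simp
  moreover have "\<not> P dvd M"
  proof
    assume PM: "P dvd M"
    obtain q where "p = Suc q" using assms(2) by (cases p) auto
    then have "?S = 1 + M * (\<Sum>i<q. M ^ i)"
      by (simp add: sum.lessThan_Suc_shift sum_distrib_left del: sum.lessThan_Suc)
    then show False using PS PM unit by (metis dvd_add_left_iff dvd_mult2)
  qed
  ultimately have "P dvd pderiv N"
    using prime by (metis prime_elem_dvd_multD prime_elem_dvd_power)
  \<comment> \<open>Multiplying by X (X + 1) clears the denominators of the logarithmic derivative
    of N: X (X + 1) N' = N (a (X + 1) + b X).\<close>
  then have dvd: "P dvd [:0, 1:] * [:1, 1:] * pderiv N" by (rule dvd_mult)
  obtain a' b' where a': "a = Suc a'" and b': "b = Suc b'" using ab by (cases a; cases b) auto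
  have "X * Y * pderiv (X ^ Suc a' * Y ^ Suc b') =
      X ^ Suc a' * Y ^ Suc b' * (smult (of_nat (Suc a')) Y + smult (of_nat (Suc b')) X)"
    if "pderiv X = 1" "pderiv Y = 1" for X Y :: "bit poly"
    unfolding pderiv_mult pderiv_power_Suc that by (simp add: algebra_simps del: of_nat_Suc)
  from this[of "[:0, 1:]" "[:1, 1:]"]
  have "[:0, 1:] * [:1, 1:] * pderiv N = N * (smult (of_nat a) [:1, 1:] + smult (of_nat b) [:0, 1:])"
    by (simp only: N_def a' b' pderiv_pCons) (simp add: one_pCons)
  \<comment> \<open>Depending on the parities this linear form is X + 1, X or 1, each a divisor of
    N; it is nonzero because a and b are not both even.\<close>
  moreover have "(smult (of_nat a) [:1, 1:] + smult (of_nat b) [:0, 1 :: bit:]) dvd N"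
    using ab(4) unfolding N_def a' b' of_nat_bit
    by (cases "odd (Suc a')"; cases "odd (Suc b')")
       (auto simp flip: one_pCons simp del: mult_pCons_left mult_pCons_right)
  ultimately have "P dvd N * N" using dvd by (metis dvd_refl dvd_trans mult_dvd_mono)
  then have PN: "P dvd N" using prime by (auto dest: prime_elem_dvd_multD)
  have "N dvd M ^ i - 1" for i
    using power_diff_1_eq[of M i] by (simp add: M minus flip: add.assoc)
  then have "P dvd (\<Sum>i<p. M ^ i - 1)" using PN by (intro dvd_sum) (meson dvd_trans)
  then have "P dvd ?S - of_nat p" by (simp add: sum_subtractf)
  then have "P dvd of_nat p" using PS by (metis dvd_diff_right_iff dvd_diff_commute)
  moreover have "(of_nat p :: bit poly) = 1"
    using assms(2) by (simp add: of_nat_poly of_nat_bit one_pCons)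
  ultimately show False using unit by simp
qed

section \<open>Odd exponents of the power sum\<close>

text \<open>The power with exponent p - 1 is a square and has no odd exponents; those up to p - 3
  have degree below k. Only the power p - 2 remains.\<close>

lemma coeff_power_sum_top:
  fixes M :: "bit poly"
  assumes "odd p" "p \<ge> 3" "odd k" "(p - 3) * degree M < k"
  shows "coeff (\<Sum>i<p. M ^ i) k = coeff (M ^ (p - 2)) k"
proof -
  obtain q where q: "p = Suc (Suc (Suc q))" using assms(2) that[of "p - 3"] by simp
  have "coeff (\<Sum>i<Suc q. M ^ i) k = 0"
    using degree_power_sum_le[of M "Suc q"] assms(4) q by (intro coeff_eq_0) simp
  moreover have "coeff (M ^ Suc (Suc q)) k = 0"
  proof -
    have "even (Suc (Suc q))" using assms(1) q by simp
    then obtain h where "Suc (Suc q) = 2 * h" by (elim evenE)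
    then have "M ^ Suc (Suc q) = (M ^ h) ^ 2" by (metis power_mult mult.commute)
    then show ?thesis using coeff_square_odd assms(3) by metis
  qed
  ultimately show ?thesis unfolding q sum.lessThan_Suc[of _ "Suc (Suc q)"] sum.lessThan_Suc[of _ "Suc q"]
    by simp
qed

text \<open>The largest odd exponent occurring in the sum: the leading power \<open>M ^ (p - 1)\<close> is a square
  and contributes none, so it comes from the top two coefficients of \<open>M ^ (p - 2)\<close>.\<close>

lemma mersenne_sum_top_odd:
  assumes "mersenne_prime M" "odd p" "p \<ge> 5"
  defines "d \<equiv> degree M"
  defines "e \<equiv> (p - 1) * d - (if odd d then d else d + 1)"
  shows "odd e" "coeff (\<Sum>i<p. M ^ i) e = 1"
    "\<And>k. odd k \<Longrightarrow> k > e \<Longrightarrow> coeff (\<Sum>i<p. M ^ i) k = 0"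
proof -
  from assms(1) obtain a b where ab: "a \<ge> 1" "b \<ge> 1" "odd a \<or> odd b" "d = a + b"
    "subleading M = of_nat b" unfolding d_def by (rule mersenne_primeE)
  have M0: "M \<noteq> 0" using ab d_def by auto
  obtain r where p: "p = r + 3" "r \<ge> 2" using assms(3) that[of "p - 3"] by simp
  \<comment> \<open>Here r + 1 = p - 2 is odd, so \<open>e\<close> is the largest odd number not
    exceeding the degree of \<open>M ^ (p - 2)\<close>.\<close>
  have e: "e = (r + 1) * d - (if odd d then 0 else 1)"
    by (simp add: e_def p algebra_simps)
  have "2 \<le> d" using ab by simp
  then have rd: "r * d + 2 \<le> (r + 1) * d" by simp
  have "(if odd d then 0 else 1 :: nat) \<le> 1" by simp
  then have low: "r * d < e" using rd unfolding e by linarith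
  have er: "even r" using assms(2) p by simp
  show "odd e" using rd er by (auto simp: e)
  have deg: "degree (M ^ (r + 1)) = (r + 1) * d" unfolding degree_power_eq[OF M0] d_def ..
  have coeff: "coeff (\<Sum>i<p. M ^ i) k = coeff (M ^ (r + 1)) k" if "odd k" "k \<ge> e" for k
    using coeff_power_sum_top[of p k M] that low assms(2,3) p d_def by simp
  show "coeff (\<Sum>i<p. M ^ i) e = 1"
  proof (cases "odd d")
    case True
    then show ?thesis
      using coeff[of e] \<open>odd e\<close> deg lead_coeff_bit_poly[of "M ^ (r + 1)"] M0 by (simp add: e)
  next
    case False
    \<comment> \<open>The exponents a and b have an even sum and are not both even, so both are
      odd.\<close>
    then have "odd b" using ab by auto
    then have "subleading (M ^ (r + 1)) = 1"
      using M0 er ab by (simp add: subleading_power of_nat_bit del: power_Suc)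
    then show ?thesis
      using coeff[of e] \<open>odd e\<close> deg rd False by (simp add: e subleading_altdef split: if_splits)
  qed
  show "coeff (\<Sum>i<p. M ^ i) k = 0" if "odd k" "k > e" for k
  proof -
    \<comment> \<open>If \<open>e\<close> is below (r + 1) d, then it is so by one and (r + 1) d is
      even, hence different from k.\<close>
    have "k > (r + 1) * d" using that er by (cases "k = (r + 1) * d") (auto simp: e split: if_splits)
    then show ?thesis using coeff[of k] that deg by (simp add: coeff_eq_0)
  qed
qed

text \<open>Each 1 + P splits into powers of X and X + 1. The exponents add up over the product, as
  do the degrees and second highest coefficients of the factors P, so the total degree and the
  parity of v can be read off \<open>\<Prod>A\<close>.\<close>

lemma prod_one_add_mersenne:
  assumes "finite A" "\<And>P. P \<in> A \<Longrightarrow> mersenne_prime P"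
  shows "\<exists>u v. (\<Prod>P\<in>A. 1 + P) = [:0, 1:] ^ u * [:1, 1:] ^ v \<and> degree (\<Prod>A) = u + v \<and>
    subleading (\<Prod>A) = of_nat v"
  using assms
proof (induction A rule: finite_induct)
  case empty
  show ?case by (intro exI[of _ 0]) (simp add: subleading_altdef)
next
  case (insert P A)
  then obtain u v where uv: "(\<Prod>P\<in>A. 1 + P) = [:0, 1:] ^ u * [:1, 1:] ^ v"
    "degree (\<Prod>A) = u + v" "subleading (\<Prod>A) = of_nat v" by auto
  have "mersenne_prime P" using insert by simp
  then obtain a b where P: "P = 1 + [:0, 1:] ^ a * [:1, 1:] ^ b"
    "degree P = a + b" "subleading P = of_nat b" by (rule mersenne_primeE)
  have "1 + P = [:0, 1:] ^ a * [:1, 1:] ^ b" using P(1) by (simp flip: add.assoc)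
  then have "(\<Prod>P\<in>insert P A. 1 + P) = [:0, 1:] ^ (a + u) * [:1, 1:] ^ (b + v)"
    using insert.hyps uv(1) by (simp add: power_add mult_ac del: mult_pCons_left mult_pCons_right)
  moreover have nz: "P \<noteq> 0" "\<Prod>A \<noteq> 0"
    using insert by (auto simp: mersenne_prime_def irreducible_def)
  then have "degree (\<Prod>(insert P A)) = (a + u) + (b + v)"
    using insert.hyps uv(2) P(2) by (simp add: degree_mult_eq)
  moreover have "subleading (\<Prod>(insert P A)) = of_nat (b + v)"
    using insert.hyps uv(3) P(3) nz by (simp add: subleading_mult)
  ultimately show ?case by blast
qed

lemma odd_coeff_sigma_mersenne_prod:
  assumes "finite A" "\<And>P. P \<in> A \<Longrightarrow> mersenne_prime P"
    and "even (degree (\<Prod>A))" "subleading (\<Prod>A) = 0" "odd k"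
  shows "coeff (sigma (\<Prod>A)) k = 0"
proof -
  from prod_one_add_mersenne[OF assms(1,2)] obtain u v
    where uv: "(\<Prod>P\<in>A. 1 + P) = [:0, 1:] ^ u * [:1, 1:] ^ v"
      "degree (\<Prod>A) = u + v" "subleading (\<Prod>A) = of_nat v" by auto
  have "even u" "even v" using uv assms(3,4) by (auto simp: of_nat_bit)
  then obtain u' v' where "u = u' * 2" "v = v' * 2" by (auto elim!: evenE)
  then have "sigma (\<Prod>A) = ([:0, 1:] ^ u' * [:1, 1:] ^ v') ^ 2"
    using sigma_prod_irreducible[OF assms(1)] assms(2) uv(1)
    by (simp add: mersenne_prime_def power_mult power_mult_distrib)
  then show ?thesis using coeff_square_odd assms(5) by metis
qed

section \<open>Locating M in the exceptional set\<close>

lemma mersenne_sum_nonMersenne_factor: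
  assumes "odd p" "p \<ge> 5" "mersenne_prime M" "M \<notin> Sigma_set p"
  shows "\<exists>P. irreducible P \<and> \<not> mersenne_prime P \<and> P dvd (\<Sum>i<p. M ^ i)"
proof (rule ccontr)
  let ?S = "\<Sum>i<p. M ^ i"
  assume "\<not> ?thesis"
  then have all: "mersenne_prime P" if "irreducible P" "P dvd ?S" for P using that by blast
  define d where "d = degree M"
  define L where "L = (if odd d then d else d + 1)"
  define e where "e = (p - 1) * d - L"
  have d2: "d \<ge> 2" using assms(3) unfolding d_def by (auto elim!: mersenne_primeE)
  have M0: "M \<noteq> 0" using d2 d_def by auto
  have evp: "even (p - 1)" using assms(1,2) by simp
  have "4 * d \<le> (p - 1) * d" using assms(2) by (intro mult_right_mono) auto
  moreover have "L \<le> d + 1" by (simp add: L_def)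
  \<comment> \<open>The bounds p \<ge> 5 and d \<ge> 2 keep the subtraction in \<open>e\<close> from
    being truncated.\<close>
  ultimately have D: "e + L = (p - 1) * d" "L < e" using d2 unfolding e_def by linarith+
  note top = mersenne_sum_top_odd[OF assms(3,1,2), folded d_def, folded L_def, folded e_def]
  have S0: "?S \<noteq> 0" using top(2) by auto
  have degS: "degree ?S = (p - 1) * d"
  proof (rule antisym)
    show "degree ?S \<le> (p - 1) * d" unfolding d_def by (rule degree_power_sum_le)
    obtain q where q: "p = Suc (Suc q)" using assms(2) that[of "p - 2"] by simp
    have "degree (\<Sum>i<Suc q. M ^ i) < degree (M ^ Suc q)"
      using degree_power_sum_le[of M "Suc q"] M0 d2 unfolding degree_power_eq[OF M0] d_def
      by simp
    then have "degree ((\<Sum>i<Suc q. M ^ i) + M ^ Suc q) = degree (M ^ Suc q)"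
      by (rule degree_add_eq_right)
    then show "(p - 1) * d \<le> degree ?S"
      unfolding q sum.lessThan_Suc[of _ "Suc q"] degree_power_eq[OF M0] d_def by simp
  qed
  \<comment> \<open>The exponent just below the even degree of S is odd, and it exceeds
    \<open>e\<close> because \<open>L\<close>, being odd and at least d, is at least 3.\<close>
  have "subleading ?S = 0"
    using top(3)[of "degree ?S - 1"] D d2 evp degS
    by (auto simp: subleading_altdef L_def split: if_splits)
  moreover obtain A where A: "finite A" "\<And>P. P \<in> A \<Longrightarrow> irreducible P" "?S = \<Prod>A"
    using squarefree_prod_irreducible[OF S0] mersenne_sum_squarefree[OF assms(3,1)] by metis
  moreover have "mersenne_prime P" if "P \<in> A" for P
    using that A by (intro all) (auto intro: dvd_prodI)
  ultimately have U: "coeff (sigma ?S) k = 0" if "odd k" for k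
    using odd_coeff_sigma_mersenne_prod[of A k] that degS evp by simp
  have "2 * ((p - 1) div 2) = p - 1" using evp by simp
  moreover have "sigma (M ^ (p - 1)) = ?S"
    using sigma_power_irreducible[of M "p - 1"] assms(2,3)
    by (simp add: mersenne_prime_def lessThan_Suc_atMost[symmetric])
  ultimately have W: "W_poly p M = sigma ?S + ?S + 1"
    by (simp add: W_poly_def U_poly_def)
  define w where "w = degree (W_poly p M)"
  \<comment> \<open>Neither \<open>sigma ?S\<close> nor the constant 1 has an odd exponent.\<close>
  have coeffW: "coeff (W_poly p M) k = coeff ?S k" if "odd k" for k
    using that U by (simp add: W coeff_1 odd_pos)
  have We: "coeff (W_poly p M) e = 1" using coeffW top by simp
  then have W0: "W_poly p M \<noteq> 0" and ew: "e \<le> w" by (auto simp: w_def intro: le_degree)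
  have c: "c_num p M = int (e + L) - int w"
  proof -
    have "2 * int ((p - 1) div 2) = int (p - 1)"
      using evp by (metis dvd_mult_div_cancel of_nat_mult of_nat_numeral)
    then show ?thesis by (simp add: c_num_def Let_def D(1) w_def d_def)
  qed
  have cdef: "c_defined p M" using W0 by (simp add: c_defined_def)
  have L: "L = d \<or> L = d + 1" and oddL: "odd L" by (auto simp: L_def)
  show False
  proof (cases "odd w")
    case True
    \<comment> \<open>An odd degree of W is its largest odd exponent, that is \<open>e\<close>. So
      \<open>c_num\<close> is \<open>L\<close>, which is d (first set) or d + 1 (second
      set).\<close>
    then have "w = e"
      using ew top(3)[of w] coeffW[of w] W0 by (cases "w = e") (auto simp: w_def)
    then have "c_num p M = int L" using c by simp
    then have "M \<in> Sigma1 p \<union> Sigma2 p"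
      using L oddL assms(3) cdef by (auto simp: Sigma1_def Sigma2_def d_def)
    then show False using assms(4) by (auto simp: Sigma_set_def)
  next
    case False
    \<comment> \<open>For even \<open>w\<close> the odd indices, counted from the top, correspond to
      odd exponents. The least one belongs to the largest exponent \<open>e\<close>, so
      \<open>c_num\<close> and \<open>m_num\<close> add up to \<open>L\<close>.\<close>
    then have m: "is_odd_index p M (w - e)"
      using ew top(1) We by (simp add: is_odd_index_def alpha_def flip: w_def)
    then have mdef: "m_defined p M" using cdef False by (auto simp: m_defined_def w_def)
    have "w - e \<le> k" if "is_odd_index p M k" for k
    proof (rule ccontr)
      assume "\<not> w - e \<le> k"
      then have "e < w - k" by simp
      moreover have "odd (w - k)" using that False by (simp add: is_odd_index_def w_def)
      ultimately have "coeff (W_poly p M) (w - k) = 0" using coeffW top(3) by simp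
      then show False using that by (simp add: is_odd_index_def alpha_def w_def)
    qed
    then have mnum: "m_num p M = w - e" unfolding m_num_def using m by (intro Least_equality) auto
    then have sum: "c_num p M + int (m_num p M) = int L" using c ew by simp
    have evc: "even (c_num p M)"
      using c top(1) oddL False by simp
    have oddm: "odd (m_num p M)" using m mnum by (simp add: is_odd_index_def)
    have "M \<in> Sigma1 p \<union> Sigma3 p \<union> Sigma4 p"
    proof (cases "L = d")
      case True
      then show ?thesis using assms(3) cdef mdef sum evc by (auto simp: Sigma3_def d_def)
    next
      case False
      then have Ld: "L = d + 1" using L by simp
      show ?thesis
      proof (cases "m_num p M \<ge> 3")
        case True
        then show ?thesis using assms(3) cdef mdef sum evc Ld by (auto simp: Sigma4_def d_def)
      next
        case False
        then have "m_num p M = 1 \<or> m_num p M = 0 \<or> m_num p M = 2" by linarith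
        \<comment> \<open>In this remaining case \<open>c_num\<close> is (d + 1) - 1 = d, which is
          the condition of the first set.\<close>
        then have "m_num p M = 1" using oddm by auto
        then show ?thesis using assms(3) cdef sum Ld by (auto simp: Sigma1_def d_def)
      qed
    qed
    then show False using assms(4) by (auto simp: Sigma_set_def)
  qed
qed

theorem theorem1p1:
  fixes p :: nat and M :: "bit poly"
  assumes "prime p" and "p \<ge> 5"
    and "mersenne_prime M" and "M \<notin> Sigma_set p"
  shows "pcompose (cyclotomic_mod2 p) M = (\<Sum>i<p. M ^ i) \<and>
         (\<Sum>i<p. M ^ i) = sigma (M ^ (p - 1)) \<and>
         (\<exists>P. irreducible P \<and> \<not> mersenne_prime P \<and> P dvd pcompose (cyclotomic_mod2 p) M)"
proof -
  have "odd p" using assms(1,2) by (intro prime_odd_nat) auto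
  moreover have "sigma (M ^ (p - 1)) = (\<Sum>i<p. M ^ i)"
    using sigma_power_irreducible[of M "p - 1"] assms(2,3)
    by (simp add: mersenne_prime_def lessThan_Suc_atMost[symmetric])
  ultimately show ?thesis
    using mersenne_sum_nonMersenne_factor assms pcompose_cyclotomic_mod2 by simp
qed

end
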